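(* Let $n\ge 2$ and let $\mathcal V$ be a variety of Boolean-like algebras of dimension $n$. Then $\mathcal V$ is generated (as a variety) by the class $\{\mathbf A\in\mathcal V: |A|=n\}$. In particular, the variety of pure Boolean-like algebras of dimension $n$ is generated by the algebra $\mathbf n$.
   Context: Fix $n\ge 2$. An algebra $\mathbf A$ of type $\tau$ is an algebra of dimension $n$ ($n$DA) with respect to $\tau$-terms $q$ (of arity $n+1$) and constant terms $\mathsf e_1,\dots,\mathsf e_n$ if $q^{\mathbf A}(\mathsf e_i^{\mathbf A},b_1,\dots,b_n)=b_i$ for all $b_j\in A$, $1\le i\le n$. $\theta(a,b)$ is the smallest congruence containing $(a,b)$. An element $c$ is $n$-central if the map $a\mapsto (a/\theta(c,\mathsf e_1),\dots,a/\theta(c,\mathsf e_n))$ is an isomorphism from $\mathbf A$ onto $\prod_{i=1}^n\mathbf A/\theta(c,\mathsf e_i)$. An $n$BA is an $n$DA all of whose elements are $n$-central. A variety of $n$BAs is a variety $\mathcal V$ of type $\tau$ each member of which is an $n$BA with respect to the same terms $q,\mathsf e_1,\dots,\mathsf e_n$. A pure $n$BA is an $n$BA of type $\nu_n=(q,\mathsf e_1,\dots,\mathsf e_n)$ ($q$ of arity $n+1$, each $\mathsf e_i$ nullary) with respect to these basic operations. The algebra $\mathbf n$ has universe $\{\mathsf e_1,\dots,\mathsf e_n\}$ ($n$ distinct elements), the constants interpreted as themselves, and $q^{\mathbf n}(\mathsf e_i,x_1,\dots,x_n)=x_i$. *)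

theory Defs
  imports Main "HOL-Library.FuncSet"
begin

text \<open>
  A similarity type is a partial map from symbols to arities; its domain is the set of operation
  symbols. Terms are built over countably many variables.
\<close>

type_synonym 'f signature = "'f \<Rightarrow> nat option"

datatype 'f tm = Var nat | Fun 'f "'f tm list"

primrec vars :: "'f tm \<Rightarrow> nat set" where
  "vars (Var x) = {x}"
| "vars (Fun f ts) = \<Union> (set (map vars ts))"

primrec wf_tm :: "'f signature \<Rightarrow> 'f tm \<Rightarrow> bool" where
  "wf_tm \<tau> (Var x) \<longleftrightarrow> True"
| "wf_tm \<tau> (Fun f ts) \<longleftrightarrow> \<tau> f = Some (length ts) \<and> list_all (wf_tm \<tau>) ts"

text \<open>
  Values of \<open>oper\<close> on symbols outside the signature, on lists of the wrong length, or on arguments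
  outside the universe are irrelevant; no notion below depends on them.
\<close>

record ('f, 'a) algebra =
  univ :: "'a set"
  oper :: "'f \<Rightarrow> 'a list \<Rightarrow> 'a"

definition is_algebra :: "'f signature \<Rightarrow> ('f, 'a) algebra \<Rightarrow> bool" where
  "is_algebra \<tau> A \<longleftrightarrow> univ A \<noteq> {} \<and>
     (\<forall>f xs. \<tau> f = Some (length xs) \<and> set xs \<subseteq> univ A \<longrightarrow> oper A f xs \<in> univ A)"

primrec eval :: "('f, 'a) algebra \<Rightarrow> (nat \<Rightarrow> 'a) \<Rightarrow> 'f tm \<Rightarrow> 'a" where
  "eval A \<rho> (Var x) = \<rho> x"
| "eval A \<rho> (Fun f ts) = oper A f (map (eval A \<rho>) ts)"

text \<open>
  The \<open>k\<close>-ary term operation of a term whose variables are among \<open>Var 0, \<dots>, Var (k - 1)\<close>, applied to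
  a list of \<open>k\<close> elements.
\<close>

definition term_op :: "('f, 'a) algebra \<Rightarrow> 'f tm \<Rightarrow> 'a list \<Rightarrow> 'a" where
  "term_op A t xs = eval A (\<lambda>i. xs ! i) t"

subsection \<open>Varieties\<close>

definition satisfies :: "('f, 'a) algebra \<Rightarrow> 'f tm \<times> 'f tm \<Rightarrow> bool" where
  "satisfies A st \<longleftrightarrow> (\<forall>\<rho>. range \<rho> \<subseteq> univ A \<longrightarrow> eval A \<rho> (fst st) = eval A \<rho> (snd st))"

definition models :: "'f signature \<Rightarrow> ('f tm \<times> 'f tm) set \<Rightarrow> ('f, 'a) algebra set" where
  "models \<tau> \<Sigma> = {A. is_algebra \<tau> A \<and> (\<forall>st\<in>\<Sigma>. satisfies A st)}"

text \<open>
  Varieties are equational classes. The type \<open>'a\<close> plays the role of the set-theoretic universe from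
  which universes of algebras are taken. Closure under H, S and P would not do as a definition over
  a fixed \<open>'a\<close>, since direct products of algebras over \<open>'a\<close> need not fit into \<open>'a\<close>.
\<close>

definition variety :: "'f signature \<Rightarrow> ('f, 'a) algebra set \<Rightarrow> bool" where
  "variety \<tau> V \<longleftrightarrow>
     (\<exists>\<Sigma>. (\<forall>(s, t)\<in>\<Sigma>. wf_tm \<tau> s \<and> wf_tm \<tau> t) \<and> V = models \<tau> \<Sigma>)"

definition generated_variety ::
    "'f signature \<Rightarrow> ('f, 'a) algebra set \<Rightarrow> ('f, 'a) algebra set" where
  "generated_variety \<tau> K = \<Inter> {V. variety \<tau> V \<and> K \<subseteq> V}"

subsection \<open>Congruences, quotients, products, isomorphisms\<close>

definition congruence :: "'f signature \<Rightarrow> ('f, 'a) algebra \<Rightarrow> ('a \<times> 'a) set \<Rightarrow> bool" where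
  "congruence \<tau> A r \<longleftrightarrow> equiv (univ A) r \<and>
     (\<forall>f xs ys. \<tau> f = Some (length xs) \<and> list_all2 (\<lambda>x y. (x, y) \<in> r) xs ys
        \<longrightarrow> (oper A f xs, oper A f ys) \<in> r)"

definition princ_cong :: "'f signature \<Rightarrow> ('f, 'a) algebra \<Rightarrow> 'a \<Rightarrow> 'a \<Rightarrow> ('a \<times> 'a) set" where
  "princ_cong \<tau> A a b = \<Inter> {r. congruence \<tau> A r \<and> (a, b) \<in> r}"

definition quotient_alg :: "('f, 'a) algebra \<Rightarrow> ('a \<times> 'a) set \<Rightarrow> ('f, 'a set) algebra" where
  "quotient_alg A r =
     \<lparr> univ = univ A // r,
       oper = (\<lambda>f Xs. r `` {oper A f (map (\<lambda>X. SOME x. x \<in> X) Xs)}) \<rparr>"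

definition product_alg :: "'i set \<Rightarrow> ('i \<Rightarrow> ('f, 'a) algebra) \<Rightarrow> ('f, 'i \<Rightarrow> 'a) algebra" where
  "product_alg I B =
     \<lparr> univ = (\<Pi>\<^sub>E i\<in>I. univ (B i)),
       oper = (\<lambda>f xs. \<lambda>i\<in>I. oper (B i) f (map (\<lambda>x. x i) xs)) \<rparr>"

definition alg_iso ::
    "'f signature \<Rightarrow> ('f, 'a) algebra \<Rightarrow> ('f, 'b) algebra \<Rightarrow> ('a \<Rightarrow> 'b) \<Rightarrow> bool" where
  "alg_iso \<tau> A B h \<longleftrightarrow> bij_betw h (univ A) (univ B) \<and>
     (\<forall>f xs. \<tau> f = Some (length xs) \<and> set xs \<subseteq> univ A
        \<longrightarrow> h (oper A f xs) = oper B f (map h xs))"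

subsection \<open>Boolean-like algebras of dimension \<open>n\<close>\<close>

definition dim_terms :: "'f signature \<Rightarrow> nat \<Rightarrow> 'f tm \<Rightarrow> (nat \<Rightarrow> 'f tm) \<Rightarrow> bool" where
  "dim_terms \<tau> n q e \<longleftrightarrow> wf_tm \<tau> q \<and> vars q \<subseteq> {0..n} \<and>
     (\<forall>i\<in>{1..n}. wf_tm \<tau> (e i) \<and> vars (e i) = {})"

definition is_nDA ::
    "'f signature \<Rightarrow> nat \<Rightarrow> 'f tm \<Rightarrow> (nat \<Rightarrow> 'f tm) \<Rightarrow> ('f, 'a) algebra \<Rightarrow> bool" where
  "is_nDA \<tau> n q e A \<longleftrightarrow> is_algebra \<tau> A \<and> dim_terms \<tau> n q e \<and>
     (\<forall>b. (\<forall>j\<in>{1..n}. b j \<in> univ A) \<longrightarrow>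
        (\<forall>i\<in>{1..n}. term_op A q (term_op A (e i) [] # map b [1..<Suc n]) = b i))"

definition n_central ::
    "'f signature \<Rightarrow> nat \<Rightarrow> (nat \<Rightarrow> 'f tm) \<Rightarrow> ('f, 'a) algebra \<Rightarrow> 'a \<Rightarrow> bool" where
  "n_central \<tau> n e A c \<longleftrightarrow>
     (let \<theta> = (\<lambda>i. princ_cong \<tau> A c (term_op A (e i) []))
      in alg_iso \<tau> A (product_alg {1..n} (\<lambda>i. quotient_alg A (\<theta> i)))
           (\<lambda>a. \<lambda>i\<in>{1..n}. \<theta> i `` {a}))"

definition is_nBA ::
    "'f signature \<Rightarrow> nat \<Rightarrow> 'f tm \<Rightarrow> (nat \<Rightarrow> 'f tm) \<Rightarrow> ('f, 'a) algebra \<Rightarrow> bool" where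
  "is_nBA \<tau> n q e A \<longleftrightarrow> is_nDA \<tau> n q e A \<and> (\<forall>c\<in>univ A. n_central \<tau> n e A c)"

definition variety_of_nBAs ::
    "'f signature \<Rightarrow> nat \<Rightarrow> 'f tm \<Rightarrow> (nat \<Rightarrow> 'f tm) \<Rightarrow> ('f, 'a) algebra set \<Rightarrow> bool" where
  "variety_of_nBAs \<tau> n q e V \<longleftrightarrow> variety \<tau> V \<and> (\<forall>A\<in>V. is_nBA \<tau> n q e A)"

subsection \<open>Pure Boolean-like algebras of dimension \<open>n\<close>\<close>

datatype nu_sym = Qsym | Esym nat

definition nu_sig :: "nat \<Rightarrow> nu_sym signature" where
  "nu_sig n = (\<lambda>s. case s of Qsym \<Rightarrow> Some (Suc n)
                           | Esym i \<Rightarrow> if i \<in> {1..n} then Some 0 else None)"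

definition is_pure_nBA :: "nat \<Rightarrow> (nu_sym, 'a) algebra \<Rightarrow> bool" where
  "is_pure_nBA n A \<longleftrightarrow>
     is_nBA (nu_sig n) n (Fun Qsym (map Var [0..<Suc n])) (\<lambda>i. Fun (Esym i) []) A"

text \<open>
  The algebra \<open>\<^bold>n\<close> on the elements \<open>\<epsilon> 1, \<dots>, \<epsilon> n\<close>, which are meant to be pairwise distinct
  (\<open>inj_on \<epsilon> {1..n}\<close>). For \<open>x = \<epsilon> i\<close>, the operation \<open>Qsym\<close> sends \<open>[x, x\<^sub>1, \<dots>, x\<^sub>n]\<close> to \<open>x\<^sub>i\<close>,
  which is the entry at position \<open>i\<close> of this list since positions count from \<open>0\<close>.
\<close>

definition alg_n :: "nat \<Rightarrow> (nat \<Rightarrow> 'a) \<Rightarrow> (nu_sym, 'a) algebra" where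
  "alg_n n \<epsilon> =
     \<lparr> univ = \<epsilon> ` {1..n},
       oper = (\<lambda>s xs. case s of Esym i \<Rightarrow> \<epsilon> i
                              | Qsym \<Rightarrow> xs ! (the_inv_into {1..n} \<epsilon> (hd xs))) \<rparr>"

end

theory Submission
  imports Defs
begin

text \<open>
  Let \<open>a \<noteq> b\<close> in an \<open>n\<close>BA \<open>A\<close> and let \<open>r\<close> be a congruence maximal among those omitting \<open>(a, b)\<close>.
  Modulo \<open>\<theta>(c, e\<^sub>i)\<close> the element \<open>q(c, x\<^sub>1, \<dots>, x\<^sub>n)\<close> is congruent to \<open>x\<^sub>i\<close>, and by \<open>n\<close>-centrality of
  \<open>c\<close> it is the only element with this property for all \<open>i\<close>. Hence each \<open>\<theta>(c, e\<^sub>i)\<close> permutes with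
  \<open>r\<close>, and the congruences \<open>\<theta>(c, e\<^sub>i) O r\<close> intersect in \<open>r\<close>. One of them omits \<open>(a, b)\<close>, so it
  equals \<open>r\<close> and \<open>c\<close> is congruent to \<open>e\<^sub>i\<close> modulo \<open>r\<close>. The quotient by \<open>r\<close> therefore consists of
  the \<open>n\<close> distinct constants, and such quotients separate the points of \<open>A\<close>. In the pure case they
  are copies of \<open>\<^bold>n\<close>.

  Conversely, \<open>n\<close>-centrality of \<open>c\<close> follows from identities of \<open>\<^bold>n\<close> about the unary maps
  \<open>x \<mapsto> q(c, c, \<dots>, x, \<dots>, c)\<close>: their kernels are congruences that contain \<open>(c, e\<^sub>i)\<close> and intersect
  in the identity. So all algebras in the variety generated by \<open>\<^bold>n\<close> are \<open>n\<close>BAs.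
\<close>

section \<open>Congruences\<close>

lemma congruence_equiv: "congruence \<tau> A r \<Longrightarrow> equiv (univ A) r"
  unfolding congruence_def by blast

lemma congruence_oper:
  assumes "congruence \<tau> A r" and "\<tau> f = Some (length xs)"
    and "list_all2 (\<lambda>x y. (x, y) \<in> r) xs ys"
  shows "(oper A f xs, oper A f ys) \<in> r"
  using assms unfolding congruence_def by blast

lemma congruence_field: "congruence \<tau> A r \<Longrightarrow> (x, y) \<in> r \<Longrightarrow> x \<in> univ A \<and> y \<in> univ A"
  unfolding congruence_def equiv_def by blast

lemma congruence_refl: "congruence \<tau> A r \<Longrightarrow> x \<in> univ A \<Longrightarrow> (x, x) \<in> r"
  unfolding congruence_def equiv_def refl_on_def by blast

lemma congruence_sym: "congruence \<tau> A r \<Longrightarrow> (x, y) \<in> r \<Longrightarrow> (y, x) \<in> r"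
  unfolding congruence_def equiv_def sym_def by blast

lemma congruence_trans: "congruence \<tau> A r \<Longrightarrow> (x, y) \<in> r \<Longrightarrow> (y, z) \<in> r \<Longrightarrow> (x, z) \<in> r"
  unfolding congruence_def equiv_def trans_def by blast

lemma congruence_eval:
  assumes cong: "congruence \<tau> A r" and "wf_tm \<tau> t" and "\<And>x. x \<in> vars t \<Longrightarrow> (\<rho> x, \<sigma> x) \<in> r"
  shows "(eval A \<rho> t, eval A \<sigma> t) \<in> r"
  using assms(2,3)
proof (induction t)
  case (Fun f ts)
  then have "list_all2 (\<lambda>x y. (x, y) \<in> r) (map (eval A \<rho>) ts) (map (eval A \<sigma>) ts)"
    by (auto simp: list_all2_map1 list_all2_map2 list_all_iff intro!: list.rel_refl_strong)
  then show ?case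
    using congruence_oper[OF cong] Fun.prems(1) by simp
qed simp

lemma congruence_Inter:
  assumes "R \<noteq> {}" and cong: "\<And>r. r \<in> R \<Longrightarrow> congruence \<tau> A r"
  shows "congruence \<tau> A (\<Inter>R)"
proof -
  have "equiv (univ A) (\<Inter>R)"
  proof (rule equivI)
    show "\<Inter>R \<subseteq> univ A \<times> univ A"
      using assms congruence_field by fast
    show "refl_on (univ A) (\<Inter>R)" "sym (\<Inter>R)"
      using cong by (auto intro!: refl_onI symI intro: congruence_refl congruence_sym)
    show "trans (\<Inter>R)"
      using cong by (meson InterE InterI congruence_trans transI)
  qed
  moreover have "(oper A f xs, oper A f ys) \<in> \<Inter>R"
    if arity: "\<tau> f = Some (length xs)" and related: "list_all2 (\<lambda>x y. (x, y) \<in> \<Inter>R) xs ys"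
      for f xs ys
  proof
    fix r
    assume "r \<in> R"
    moreover from this have "list_all2 (\<lambda>x y. (x, y) \<in> r) xs ys"
      using related by (auto elim: list_all2_mono)
    ultimately show "(oper A f xs, oper A f ys) \<in> r"
      using congruence_oper[OF cong arity] by blast
  qed
  ultimately show ?thesis
    unfolding congruence_def by blast
qed

lemma congruence_Union_chain:
  assumes "R \<noteq> {}" and chain: "subset.chain {r. congruence \<tau> A r} R"
  shows "congruence \<tau> A (\<Union>R)"
proof -
  have cong: "congruence \<tau> A r" if "r \<in> R" for r
    using chain that unfolding subset_chain_def by blast
  have common: "\<exists>r\<in>R. S \<subseteq> r" if "finite S" "S \<subseteq> \<Union>R" for S
    using finite_subset_Union_chain[OF that assms] by blast
  have "equiv (univ A) (\<Union>R)"
  proof (rule equivI)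
    show "\<Union>R \<subseteq> univ A \<times> univ A"
      using cong congruence_field by fast
    show "refl_on (univ A) (\<Union>R)" "sym (\<Union>R)"
      using assms(1) cong
      by (auto intro!: refl_onI symI intro: congruence_refl congruence_sym)
    show "trans (\<Union>R)"
    proof (rule transI)
      fix x y z
      assume "(x, y) \<in> \<Union>R" "(y, z) \<in> \<Union>R"
      then obtain r where "r \<in> R" "(x, y) \<in> r" "(y, z) \<in> r"
        using common[of "{(x, y), (y, z)}"] by auto
      then show "(x, z) \<in> \<Union>R"
        using congruence_trans[OF cong] by blast
    qed
  qed
  moreover have "(oper A f xs, oper A f ys) \<in> \<Union>R"
    if arity: "\<tau> f = Some (length xs)" and related: "list_all2 (\<lambda>x y. (x, y) \<in> \<Union>R) xs ys"
      for f xs ys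
  proof -
    obtain r where "r \<in> R" "set (zip xs ys) \<subseteq> r"
      using common[of "set (zip xs ys)"] related by (auto simp: list_all2_iff)
    moreover from this have "list_all2 (\<lambda>x y. (x, y) \<in> r) xs ys"
      using related by (auto simp: list_all2_iff)
    ultimately show ?thesis
      using congruence_oper[OF cong arity] by blast
  qed
  ultimately show ?thesis
    unfolding congruence_def by blast
qed

lemma congruence_relcomp:
  assumes cong_r: "congruence \<tau> A r" and cong_s: "congruence \<tau> A s" and "s O r \<subseteq> r O s"
  shows "congruence \<tau> A (r O s)"
proof -
  have "equiv (univ A) (r O s)"
  proof (rule equivI)
    show "r O s \<subseteq> univ A \<times> univ A"
      using congruence_field[OF cong_r] congruence_field[OF cong_s] by blast
    show "refl_on (univ A) (r O s)"
      using congruence_refl[OF cong_r] congruence_refl[OF cong_s] by (auto intro!: refl_onI)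
    have "(r O s)\<inverse> = s O r"
      using congruence_equiv[OF cong_r] congruence_equiv[OF cong_s]
      by (simp add: converse_relcomp equiv_def sym_conv_converse_eq)
    then show "sym (r O s)"
      using assms(3) converseI[of _ _ "r O s"] by (metis subsetD symI)
    have "(r O s) O (r O s) = r O (s O r) O s"
      by (simp add: O_assoc)
    also have "\<dots> \<subseteq> r O (r O s) O s"
      by (intro relcomp_mono assms(3) order_refl)
    also have "\<dots> = (r O r) O (s O s)"
      by (simp add: O_assoc)
    also have "\<dots> \<subseteq> r O s"
      using congruence_equiv[OF cong_r] congruence_equiv[OF cong_s]
      by (intro relcomp_mono trans_O_subset) (simp_all add: equiv_def)
    finally show "trans (r O s)"
      by (auto simp: trans_def)
  qed
  moreover have "(oper A f xs, oper A f ys) \<in> r O s"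
    if arity: "\<tau> f = Some (length xs)" and related: "list_all2 (\<lambda>x y. (x, y) \<in> r O s) xs ys"
      for f xs ys
  proof -
    have "(\<lambda>x y. (x, y) \<in> r O s) = (\<lambda>x y. (x, y) \<in> r) OO (\<lambda>x y. (x, y) \<in> s)"
      by (auto simp: fun_eq_iff)
    then obtain zs where zs_related: "list_all2 (\<lambda>x y. (x, y) \<in> r) xs zs"
        "list_all2 (\<lambda>x y. (x, y) \<in> s) zs ys"
      using related by (auto simp: list.rel_compp)
    moreover have "length zs = length xs"
      using zs_related(1) by (simp add: list_all2_lengthD)
    ultimately show ?thesis
      using congruence_oper[OF cong_r arity] congruence_oper[OF cong_s, of f zs ys] arity by auto
  qed
  ultimately show ?thesis
    unfolding congruence_def by blast
qed

subsection \<open>Kernels\<close>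

definition kernel_on :: "'a set \<Rightarrow> ('a \<Rightarrow> 'b) \<Rightarrow> ('a \<times> 'a) set" where
  "kernel_on S h = Restr (kernel h) S"

lemma kernel_on_iff: "(x, y) \<in> kernel_on S h \<longleftrightarrow> x \<in> S \<and> y \<in> S \<and> h x = h y"
  unfolding kernel_on_def kernel_def by blast

lemma kernel_on_const: "kernel_on S (\<lambda>_. c) = S \<times> S"
  by (auto simp: kernel_on_iff)

lemma kernel_on_id: "kernel_on S id = Id_on S"
  by (auto simp: kernel_on_iff)

lemma list_all2_kernel_on_iff:
  "list_all2 (\<lambda>x y. (x, y) \<in> kernel_on (univ A) h) xs ys \<longleftrightarrow>
     set xs \<subseteq> univ A \<and> set ys \<subseteq> univ A \<and> map h xs = map h ys"
proof (induction xs arbitrary: ys)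
  case (Cons x xs)
  then show ?case
    by (cases ys) (auto simp: kernel_on_iff)
qed auto

lemma congruence_kernel_on_iff:
  assumes "is_algebra \<tau> A"
  shows "congruence \<tau> A (kernel_on (univ A) h) \<longleftrightarrow>
    (\<forall>f xs ys. \<tau> f = Some (length xs) \<and> set xs \<subseteq> univ A \<and> set ys \<subseteq> univ A \<and> map h xs = map h ys
       \<longrightarrow> h (oper A f xs) = h (oper A f ys))"
proof -
  have "equiv (univ A) (kernel_on (univ A) h)"
    by (auto intro!: equivI refl_onI symI transI simp: kernel_on_iff)
  moreover have "(oper A f xs, oper A f ys) \<in> kernel_on (univ A) h \<longleftrightarrow>
      h (oper A f xs) = h (oper A f ys)"
    if "\<tau> f = Some (length xs)" "set xs \<subseteq> univ A" "set ys \<subseteq> univ A" "map h xs = map h ys"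
    for f xs ys
    using assms that map_eq_imp_length_eq[OF that(4)] by (simp add: is_algebra_def kernel_on_iff)
  ultimately show ?thesis
    unfolding congruence_def list_all2_kernel_on_iff by blast
qed

lemma congruence_kernel_onI:
  assumes "is_algebra \<tau> A"
    and absorb: "\<And>f xs. \<tau> f = Some (length xs) \<Longrightarrow> set xs \<subseteq> univ A \<Longrightarrow>
      h (oper A f xs) = h (oper A f (map h xs))"
  shows "congruence \<tau> A (kernel_on (univ A) h)"
  unfolding congruence_kernel_on_iff[OF assms(1)]
proof clarify
  fix f xs ys
  assume arity: "\<tau> f = Some (length xs)" and xs_in: "set xs \<subseteq> univ A" and ys_in: "set ys \<subseteq> univ A"
    and map_eq: "map h xs = map h ys"
  have "\<tau> f = Some (length ys)"
    using arity map_eq_imp_length_eq[OF map_eq] by simp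
  then have "h (oper A f ys) = h (oper A f (map h ys))"
    by (rule absorb[OF _ ys_in])
  then show "h (oper A f xs) = h (oper A f ys)"
    using absorb[OF arity xs_in] unfolding map_eq by simp
qed

lemma congruence_total: "is_algebra \<tau> A \<Longrightarrow> congruence \<tau> A (univ A \<times> univ A)"
  using congruence_kernel_on_iff[of \<tau> A "\<lambda>_. ()"] by (simp add: kernel_on_const)

lemma congruence_Id_on: "is_algebra \<tau> A \<Longrightarrow> congruence \<tau> A (Id_on (univ A))"
  using congruence_kernel_on_iff[of \<tau> A id] by (simp add: kernel_on_id)

lemma eval_in_univ:
  assumes "is_algebra \<tau> A" and "wf_tm \<tau> t" and "\<And>x. x \<in> vars t \<Longrightarrow> \<rho> x \<in> univ A"
  shows "eval A \<rho> t \<in> univ A"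
  using congruence_eval[OF congruence_total[OF assms(1)] assms(2), of \<rho> \<rho>] assms(3) by simp

subsection \<open>Principal and maximal congruences\<close>

lemma congruence_princ_cong:
  assumes "is_algebra \<tau> A" and "a \<in> univ A" and "b \<in> univ A"
  shows "congruence \<tau> A (princ_cong \<tau> A a b)"
  unfolding princ_cong_def
  using congruence_total[OF assms(1)] assms(2,3) by (intro congruence_Inter) auto

lemma princ_cong_contains: "(a, b) \<in> princ_cong \<tau> A a b"
  unfolding princ_cong_def by blast

lemma princ_cong_least: "congruence \<tau> A r \<Longrightarrow> (a, b) \<in> r \<Longrightarrow> princ_cong \<tau> A a b \<subseteq> r"
  unfolding princ_cong_def by blast

definition maximal_omitting ::
    "'f signature \<Rightarrow> ('f, 'a) algebra \<Rightarrow> 'a \<times> 'a \<Rightarrow> ('a \<times> 'a) set \<Rightarrow> bool" where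
  "maximal_omitting \<tau> A p r \<longleftrightarrow> congruence \<tau> A r \<and> p \<notin> r \<and>
     (\<forall>s. congruence \<tau> A s \<and> r \<subseteq> s \<and> p \<notin> s \<longrightarrow> s = r)"

lemma ex_maximal_omitting:
  assumes "is_algebra \<tau> A" and "a \<noteq> b"
  shows "\<exists>r. maximal_omitting \<tau> A (a, b) r"
proof -
  let ?C = "{r. congruence \<tau> A r \<and> (a, b) \<notin> r}"
  have "\<exists>r\<in>?C. \<forall>s\<in>?C. r \<subseteq> s \<longrightarrow> s = r"
  proof (rule subset_Zorn_nonempty)
    show "?C \<noteq> {}"
      using congruence_Id_on[OF assms(1)] assms(2) by auto
  next
    fix R
    assume "R \<noteq> {}" and chain: "subset.chain ?C R"
    then have "congruence \<tau> A (\<Union>R)"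
      by (intro congruence_Union_chain) (auto simp: subset_chain_def)
    then show "\<Union>R \<in> ?C"
      using chain by (auto simp: subset_chain_def)
  qed
  then show ?thesis
    unfolding maximal_omitting_def by blast
qed

section \<open>Homomorphisms and generated varieties\<close>

definition alg_hom ::
    "'f signature \<Rightarrow> ('f, 'a) algebra \<Rightarrow> ('f, 'b) algebra \<Rightarrow> ('a \<Rightarrow> 'b) \<Rightarrow> bool" where
  "alg_hom \<tau> A B h \<longleftrightarrow> h ` univ A \<subseteq> univ B \<and>
     (\<forall>f xs. \<tau> f = Some (length xs) \<and> set xs \<subseteq> univ A
        \<longrightarrow> h (oper A f xs) = oper B f (map h xs))"

lemma alg_hom_eval:
  assumes alg: "is_algebra \<tau> A" and hom: "alg_hom \<tau> A B h" and range_in: "range \<rho> \<subseteq> univ A"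
    and "wf_tm \<tau> t"
  shows "h (eval A \<rho> t) = eval B (h \<circ> \<rho>) t"
  using assms(4)
proof (induction t)
  case (Fun f ts)
  have "set (map (eval A \<rho>) ts) \<subseteq> univ A"
    using Fun.prems eval_in_univ[OF alg _ range_subsetD[OF range_in]] by (auto simp: list_all_iff)
  then have "h (eval A \<rho> (Fun f ts)) = oper B f (map h (map (eval A \<rho>) ts))"
    using hom Fun.prems unfolding alg_hom_def by simp
  also have "map h (map (eval A \<rho>) ts) = map (eval B (h \<circ> \<rho>)) ts"
    using Fun by (simp add: list_all_iff comp_def)
  finally show ?case by (simp add: comp_def)
qed simp

lemma satisfiesD: "satisfies A (s, t) \<Longrightarrow> range \<rho> \<subseteq> univ A \<Longrightarrow> eval A \<rho> s = eval A \<rho> t"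
  unfolding satisfies_def by simp

lemma hom_image_is_algebra:
  assumes alg: "is_algebra \<tau> A" and hom: "alg_hom \<tau> A B h" and onto: "h ` univ A = univ B"
  shows "is_algebra \<tau> B"
  unfolding is_algebra_def
proof (intro conjI allI impI)
  show "univ B \<noteq> {}"
    using alg onto unfolding is_algebra_def by auto
next
  fix f ys
  assume ys_in: "\<tau> f = Some (length ys) \<and> set ys \<subseteq> univ B"
  then have "ys \<in> map h ` lists (univ A)"
    unfolding lists_image[symmetric] onto by (simp add: in_lists_conv_set subset_iff)
  then obtain xs where "set xs \<subseteq> univ A" "ys = map h xs"
    by auto
  then have "oper B f ys = h (oper A f xs)" "oper A f xs \<in> univ A"
    using alg hom ys_in unfolding alg_hom_def is_algebra_def by auto
  then show "oper B f ys \<in> univ B"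
    using onto by blast
qed

lemma hom_image_satisfies:
  assumes "is_algebra \<tau> A" and hom: "alg_hom \<tau> A B h" and onto: "h ` univ A = univ B"
    and "wf_tm \<tau> s" and "wf_tm \<tau> t" and identity: "satisfies A (s, t)"
  shows "satisfies B (s, t)"
  unfolding satisfies_def fst_conv snd_conv
proof (intro allI impI)
  fix \<sigma> :: "nat \<Rightarrow> _"
  assume range_in: "range \<sigma> \<subseteq> univ B"
  define \<rho> where "\<rho> = inv_into (univ A) h \<circ> \<sigma>"
  have lift_in: "range \<rho> \<subseteq> univ A" and \<sigma>_eq: "\<sigma> = h \<circ> \<rho>"
    using range_in unfolding \<rho>_def onto[symmetric]
    by (auto simp: fun_eq_iff f_inv_into_f image_subset_iff intro: inv_into_into)
  show "eval B \<sigma> s = eval B \<sigma> t"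
    using alg_hom_eval[OF assms(1) hom lift_in] assms(4,5) satisfiesD[OF identity lift_in]
    unfolding \<sigma>_eq by metis
qed

lemma hom_image_in_variety:
  assumes "variety \<tau> V" and "A \<in> V" and "alg_hom \<tau> A B h" and "h ` univ A = univ B"
  shows "B \<in> V"
proof -
  obtain \<Sigma> where wf_identities: "\<forall>(s, t)\<in>\<Sigma>. wf_tm \<tau> s \<and> wf_tm \<tau> t" and V_eq: "V = models \<tau> \<Sigma>"
    using assms(1) unfolding variety_def by blast
  have A_model: "is_algebra \<tau> A" "\<forall>st\<in>\<Sigma>. satisfies A st"
    using assms(2) unfolding V_eq models_def by auto
  have "satisfies B (s, t)" if "(s, t) \<in> \<Sigma>" for s t
    using hom_image_satisfies[OF A_model(1) assms(3,4)] wf_identities A_model(2) that by blast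
  then show ?thesis
    using hom_image_is_algebra[OF A_model(1) assms(3,4)] unfolding V_eq models_def by auto
qed

definition image_alg :: "('f, 'a) algebra \<Rightarrow> ('a \<Rightarrow> 'b) \<Rightarrow> ('f, 'b) algebra" where
  "image_alg A h =
     \<lparr> univ = h ` univ A,
       oper = (\<lambda>f ys. h (oper A f (map (inv_into (univ A) h) ys))) \<rparr>"

lemma alg_hom_image_alg:
  assumes alg: "is_algebra \<tau> A" and cong: "congruence \<tau> A (kernel_on (univ A) h)"
  shows "alg_hom \<tau> A (image_alg A h) h"
  unfolding alg_hom_def
proof (intro conjI allI impI)
  fix f xs
  assume args: "\<tau> f = Some (length xs) \<and> set xs \<subseteq> univ A"
  let ?ys = "map (inv_into (univ A) h) (map h xs)"
  have "set ?ys \<subseteq> univ A" "map h xs = map h ?ys"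
    using args by (auto simp: f_inv_into_f subset_iff intro: inv_into_into)
  then have "h (oper A f xs) = h (oper A f ?ys)"
    using cong args unfolding congruence_kernel_on_iff[OF alg] by blast
  then show "h (oper A f xs) = oper (image_alg A h) f (map h xs)"
    by (simp add: image_alg_def)
qed (simp add: image_alg_def)

lemma variety_models:
  "(\<forall>(s, t)\<in>\<Sigma>. wf_tm \<tau> s \<and> wf_tm \<tau> t) \<Longrightarrow> variety \<tau> (models \<tau> \<Sigma>)"
  unfolding variety_def by (intro exI[of _ \<Sigma>] conjI refl)

lemma generated_variety_least: "variety \<tau> V \<Longrightarrow> K \<subseteq> V \<Longrightarrow> generated_variety \<tau> K \<subseteq> V"
  unfolding generated_variety_def by blast

lemma generated_variety_is_algebra:
  assumes "A \<in> generated_variety \<tau> K" and "\<And>B. B \<in> K \<Longrightarrow> is_algebra \<tau> B"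
  shows "is_algebra \<tau> A"
proof -
  have "generated_variety \<tau> K \<subseteq> models \<tau> {}"
    using assms(2) by (intro generated_variety_least variety_models) (auto simp: models_def)
  then show ?thesis
    using assms(1) by (auto simp: models_def)
qed

lemma generated_variety_satisfies:
  assumes "A \<in> generated_variety \<tau> K" and "\<And>B. B \<in> K \<Longrightarrow> is_algebra \<tau> B"
    and "wf_tm \<tau> s" and "wf_tm \<tau> t" and "\<And>B. B \<in> K \<Longrightarrow> satisfies B (s, t)"
  shows "satisfies A (s, t)"
proof -
  have "generated_variety \<tau> K \<subseteq> models \<tau> {(s, t)}"
    using assms(2-5) by (intro generated_variety_least variety_models) (auto simp: models_def)
  then show ?thesis
    using assms(1) by (auto simp: models_def)
qed

lemma residually_in_generated_variety:
  assumes alg: "is_algebra \<tau> A"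
    and separated: "\<And>a b. a \<in> univ A \<Longrightarrow> b \<in> univ A \<Longrightarrow> a \<noteq> b \<Longrightarrow>
      \<exists>B\<in>K. \<exists>h. alg_hom \<tau> A B h \<and> h a \<noteq> h b"
  shows "A \<in> generated_variety \<tau> K"
  unfolding generated_variety_def
proof clarify
  fix W
  assume "variety \<tau> W" and K_subset: "K \<subseteq> W"
  then obtain \<Sigma> where wf_identities: "\<forall>(s, t)\<in>\<Sigma>. wf_tm \<tau> s \<and> wf_tm \<tau> t" and W_eq: "W = models \<tau> \<Sigma>"
    unfolding variety_def by blast
  have "eval A \<rho> s = eval A \<rho> t" if st_in: "(s, t) \<in> \<Sigma>" and range_in: "range \<rho> \<subseteq> univ A" for s t \<rho>
  proof (rule ccontr)
    assume evals_neq: "eval A \<rho> s \<noteq> eval A \<rho> t"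
    have wf_st: "wf_tm \<tau> s" "wf_tm \<tau> t"
      using wf_identities st_in by auto
    then have "eval A \<rho> s \<in> univ A" "eval A \<rho> t \<in> univ A"
      using eval_in_univ[OF alg] range_in by blast+
    then obtain B h where B_in: "B \<in> K" and hom: "alg_hom \<tau> A B h"
        and "h (eval A \<rho> s) \<noteq> h (eval A \<rho> t)"
      using separated evals_neq by blast
    then have "eval B (h \<circ> \<rho>) s \<noteq> eval B (h \<circ> \<rho>) t"
      using alg_hom_eval[OF alg hom range_in] wf_st by simp
    moreover have "range (h \<circ> \<rho>) \<subseteq> univ B"
      using hom range_in unfolding alg_hom_def by auto
    moreover have "satisfies B (s, t)"
      using B_in K_subset st_in unfolding W_eq models_def by blast
    ultimately show False
      using satisfiesD by blast
  qed
  then show "A \<in> W"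
    unfolding W_eq models_def satisfies_def using alg by auto
qed

section \<open>Central elements\<close>

lemma quotient_alg_oper:
  assumes cong: "congruence \<tau> A r" and arity: "\<tau> f = Some (length xs)" and xs_in: "set xs \<subseteq> univ A"
  shows "oper (quotient_alg A r) f (map (\<lambda>x. r `` {x}) xs) = r `` {oper A f xs}"
proof -
  let ?rep = "\<lambda>x. SOME y. y \<in> r `` {x}"
  have "(x, ?rep x) \<in> r" if "x \<in> univ A" for x
    using someI[of "\<lambda>y. y \<in> r `` {x}" x] congruence_refl[OF cong that] by simp
  then have "list_all2 (\<lambda>x y. (x, y) \<in> r) xs (map ?rep xs)"
    using xs_in by (auto simp: list_all2_conv_all_nth subset_iff)
  then have "(oper A f xs, oper A f (map ?rep xs)) \<in> r"
    using congruence_oper[OF cong arity] by blast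
  then show ?thesis
    using equiv_class_eq[OF congruence_equiv[OF cong]] by (simp add: quotient_alg_def comp_def)
qed

definition residues :: "'i set \<Rightarrow> ('i \<Rightarrow> ('a \<times> 'a) set) \<Rightarrow> ('i \<Rightarrow> 'a) \<Rightarrow> 'i \<Rightarrow> 'a set" where
  "residues I \<theta> x = (\<lambda>i\<in>I. \<theta> i `` {x i})"

lemma residues_eq_iff:
  assumes cong: "\<And>i. i \<in> I \<Longrightarrow> congruence \<tau> A (\<theta> i)" and "x \<in> I \<rightarrow> univ A" and "y \<in> I \<rightarrow> univ A"
  shows "residues I \<theta> x = residues I \<theta> y \<longleftrightarrow> (\<forall>i\<in>I. (x i, y i) \<in> \<theta> i)"
proof -
  have "\<theta> i `` {x i} = \<theta> i `` {y i} \<longleftrightarrow> (x i, y i) \<in> \<theta> i" if "i \<in> I" for i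
    using eq_equiv_class_iff[OF congruence_equiv[OF cong[OF that]]] assms(2,3) that by blast
  then show ?thesis
    by (auto simp: residues_def fun_eq_iff restrict_def)
qed

lemma residues_oper:
  assumes cong: "\<And>i. i \<in> I \<Longrightarrow> congruence \<tau> A (\<theta> i)"
    and arity: "\<tau> f = Some (length xs)" and xs_in: "set xs \<subseteq> univ A"
  shows "residues I \<theta> (\<lambda>_. oper A f xs) =
    oper (product_alg I (\<lambda>i. quotient_alg A (\<theta> i))) f (map (\<lambda>a. residues I \<theta> (\<lambda>_. a)) xs)"
  using quotient_alg_oper[OF cong arity xs_in]
  by (simp add: product_alg_def residues_def comp_def cong: restrict_cong)

lemma univ_product_quotient:
  "univ (product_alg I (\<lambda>i. quotient_alg A (\<theta> i))) = residues I \<theta> ` (I \<rightarrow> univ A)" (is "?P = ?S")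
proof
  show "?P \<subseteq> ?S"
  proof
    fix F
    assume F_in: "F \<in> ?P"
    then have "\<forall>i\<in>I. \<exists>x\<in>univ A. F i = \<theta> i `` {x}"
      by (auto simp: product_alg_def quotient_alg_def elim!: quotientE dest!: PiE_mem)
    then obtain x where x_rep: "\<forall>i\<in>I. x i \<in> univ A \<and> F i = \<theta> i `` {x i}"
      by metis
    moreover have "F \<in> extensional I"
      using F_in by (auto simp: product_alg_def PiE_def)
    ultimately have "F = residues I \<theta> x"
      unfolding residues_def by (intro extensionalityI[of _ I]) auto
    then show "F \<in> ?S"
      using x_rep by blast
  qed
  show "?S \<subseteq> ?P"
    by (auto simp: residues_def product_alg_def quotient_alg_def intro!: quotientI)
qed

lemma alg_iso_residues_iff:
  assumes cong: "\<And>i. i \<in> I \<Longrightarrow> congruence \<tau> A (\<theta> i)"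
  shows "alg_iso \<tau> A (product_alg I (\<lambda>i. quotient_alg A (\<theta> i))) (\<lambda>a. residues I \<theta> (\<lambda>_. a)) \<longleftrightarrow>
    (\<forall>x\<in>univ A. \<forall>y\<in>univ A. (\<forall>i\<in>I. (x, y) \<in> \<theta> i) \<longrightarrow> x = y) \<and>
    (\<forall>x\<in>I \<rightarrow> univ A. \<exists>a\<in>univ A. \<forall>i\<in>I. (a, x i) \<in> \<theta> i)"
proof -
  let ?P = "product_alg I (\<lambda>i. quotient_alg A (\<theta> i))" and ?h = "\<lambda>a. residues I \<theta> (\<lambda>_. a)"
  have h_eq_iff: "?h a = residues I \<theta> x \<longleftrightarrow> (\<forall>i\<in>I. (a, x i) \<in> \<theta> i)"
    if "a \<in> univ A" "x \<in> I \<rightarrow> univ A" for a x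
    using residues_eq_iff[of I \<tau> A \<theta> "\<lambda>_. a" x] cong that by simp
  have "inj_on ?h (univ A) \<longleftrightarrow>
      (\<forall>x\<in>univ A. \<forall>y\<in>univ A. (\<forall>i\<in>I. (x, y) \<in> \<theta> i) \<longrightarrow> x = y)"
    by (simp add: inj_on_def h_eq_iff)
  moreover have "residues I \<theta> x \<in> ?h ` univ A \<longleftrightarrow> (\<exists>a\<in>univ A. \<forall>i\<in>I. (a, x i) \<in> \<theta> i)"
    if "x \<in> I \<rightarrow> univ A" for x
    unfolding image_iff eq_commute[of "residues I \<theta> x"]
    using h_eq_iff that by (intro bex_cong[OF refl]) blast
  then have "univ ?P \<subseteq> ?h ` univ A \<longleftrightarrow>
      (\<forall>x\<in>I \<rightarrow> univ A. \<exists>a\<in>univ A. \<forall>i\<in>I. (a, x i) \<in> \<theta> i)"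
    unfolding univ_product_quotient image_subset_iff by (intro ball_cong[OF refl])
  moreover have "?h ` univ A \<subseteq> univ ?P"
    unfolding univ_product_quotient by auto
  moreover have "\<forall>f xs. \<tau> f = Some (length xs) \<and> set xs \<subseteq> univ A \<longrightarrow>
      ?h (oper A f xs) = oper ?P f (map ?h xs)"
    using residues_oper[of I \<tau> A \<theta>] cong by blast
  ultimately show ?thesis
    unfolding alg_iso_def bij_betw_def by blast
qed

declare upt_Suc [simp del]

definition dim_op :: "nat \<Rightarrow> 'f tm \<Rightarrow> ('f, 'a) algebra \<Rightarrow> 'a \<Rightarrow> (nat \<Rightarrow> 'a) \<Rightarrow> 'a" where
  "dim_op n q A c x = term_op A q (c # map x [1..<Suc n])"

definition central_cong ::
    "'f signature \<Rightarrow> (nat \<Rightarrow> 'f tm) \<Rightarrow> ('f, 'a) algebra \<Rightarrow> 'a \<Rightarrow> nat \<Rightarrow> ('a \<times> 'a) set" where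
  "central_cong \<tau> e A c i = princ_cong \<tau> A c (term_op A (e i) [])"

lemma dim_op_cong:
  assumes "\<And>i. i \<in> {1..n} \<Longrightarrow> x i = y i"
  shows "dim_op n q A c x = dim_op n q A c y"
proof -
  have "map x [1..<Suc n] = map y [1..<Suc n]"
    using assms by (intro map_cong) auto
  then show ?thesis
    by (simp only: dim_op_def)
qed

lemma congruence_dim_op:
  assumes cong: "congruence \<tau> A r" and q_term: "wf_tm \<tau> q" "vars q \<subseteq> {0..n}"
    and "(c, d) \<in> r" and "\<And>i. i \<in> {1..n} \<Longrightarrow> (x i, y i) \<in> r"
  shows "(dim_op n q A c x, dim_op n q A d y) \<in> r"
  unfolding dim_op_def term_op_def
proof (rule congruence_eval[OF cong q_term(1)])
  fix i
  assume "i \<in> vars q"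
  then show "((c # map x [1..<Suc n]) ! i, (d # map y [1..<Suc n]) ! i) \<in> r"
    using q_term(2) assms(4,5) by (cases i) auto
qed

context
  fixes \<tau> :: "'f signature" and n q e and A :: "('f, 'a) algebra"
  assumes nDA: "is_nDA \<tau> n q e A"
begin

lemma nDA_is_algebra: "is_algebra \<tau> A"
  using nDA unfolding is_nDA_def by blast

lemma nDA_const_in_univ: "i \<in> {1..n} \<Longrightarrow> term_op A (e i) [] \<in> univ A"
  unfolding term_op_def
  using nDA by (intro eval_in_univ[OF nDA_is_algebra]) (auto simp: is_nDA_def dim_terms_def)

lemma nDA_dim_op_const:
  assumes "x \<in> {1..n} \<rightarrow> univ A" and "i \<in> {1..n}"
  shows "dim_op n q A (term_op A (e i) []) x = x i"
  using nDA assms unfolding is_nDA_def dim_op_def Pi_iff by blast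

lemma nDA_congruence_dim_op:
  assumes "congruence \<tau> A r" and "(c, d) \<in> r" and "\<And>i. i \<in> {1..n} \<Longrightarrow> (x i, y i) \<in> r"
  shows "(dim_op n q A c x, dim_op n q A d y) \<in> r"
  using nDA congruence_dim_op[OF assms(1) _ _ assms(2,3)] by (simp add: is_nDA_def dim_terms_def)

lemma nDA_dim_op_in_univ:
  assumes "c \<in> univ A" and "x \<in> {1..n} \<rightarrow> univ A"
  shows "dim_op n q A c x \<in> univ A"
  using nDA_congruence_dim_op[OF congruence_total[OF nDA_is_algebra], of c c x x] assms
  by (simp add: Pi_iff)

lemma nDA_dim_op_congruent:
  assumes cong: "congruence \<tau> A r" and "(c, term_op A (e i) []) \<in> r" and i_in: "i \<in> {1..n}"
    and x_in: "x \<in> {1..n} \<rightarrow> univ A"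
  shows "(dim_op n q A c x, x i) \<in> r"
  using nDA_congruence_dim_op[OF assms(1,2), of x x] nDA_dim_op_const[OF x_in i_in]
    congruence_refl[OF cong funcset_mem[OF x_in]] by simp

lemma nDA_congruent_consts:
  assumes cong: "congruence \<tau> A r" and ij_in: "i \<in> {1..n}" "j \<in> {1..n}" "i \<noteq> j"
    and consts_related: "(term_op A (e i) [], term_op A (e j) []) \<in> r"
    and xy_in: "x \<in> univ A" "y \<in> univ A"
  shows "(x, y) \<in> r"
proof -
  let ?z = "(\<lambda>_. y)(i := x)"
  have z_in: "?z \<in> {1..n} \<rightarrow> univ A"
    using xy_in by simp
  have "(dim_op n q A (term_op A (e i) []) ?z, ?z j) \<in> r"
    using nDA_dim_op_congruent[OF cong consts_related ij_in(2) z_in] .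
  then show ?thesis
    using ij_in(3) unfolding nDA_dim_op_const[OF z_in ij_in(1)] by simp
qed

lemma congruence_central_cong:
  "c \<in> univ A \<Longrightarrow> i \<in> {1..n} \<Longrightarrow> congruence \<tau> A (central_cong \<tau> e A c i)"
  unfolding central_cong_def
  by (intro congruence_princ_cong[OF nDA_is_algebra] nDA_const_in_univ)

lemma dim_op_central_cong:
  assumes "c \<in> univ A" and "i \<in> {1..n}" and "x \<in> {1..n} \<rightarrow> univ A"
  shows "(dim_op n q A c x, x i) \<in> central_cong \<tau> e A c i"
  using nDA_dim_op_congruent[OF congruence_central_cong[OF assms(1,2)] _ assms(2,3)]
    princ_cong_contains unfolding central_cong_def by metis

lemma n_central_iff:
  assumes c_in: "c \<in> univ A"
  shows "n_central \<tau> n e A c \<longleftrightarrow>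
    (\<forall>x\<in>univ A. \<forall>y\<in>univ A. (\<forall>i\<in>{1..n}. (x, y) \<in> central_cong \<tau> e A c i) \<longrightarrow> x = y)"
proof -
  have "\<exists>a\<in>univ A. \<forall>i\<in>{1..n}. (a, x i) \<in> central_cong \<tau> e A c i" if "x \<in> {1..n} \<rightarrow> univ A" for x
    using dim_op_central_cong[OF c_in _ that] nDA_dim_op_in_univ[OF c_in that] by blast
  moreover have "n_central \<tau> n e A c \<longleftrightarrow>
      alg_iso \<tau> A (product_alg {1..n} (\<lambda>i. quotient_alg A (central_cong \<tau> e A c i)))
        (\<lambda>a. residues {1..n} (central_cong \<tau> e A c) (\<lambda>_. a))"
    unfolding n_central_def Let_def residues_def central_cong_def ..
  ultimately show ?thesis
    using alg_iso_residues_iff[of "{1..n}" \<tau> A "central_cong \<tau> e A c"]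
      congruence_central_cong[OF c_in]
    by simp
qed

lemma n_central_dim_op_eqI:
  assumes central: "c \<in> univ A" "n_central \<tau> n e A c" and x_in: "x \<in> {1..n} \<rightarrow> univ A"
    and a_residues: "a \<in> univ A" "\<forall>i\<in>{1..n}. (a, x i) \<in> central_cong \<tau> e A c i"
  shows "dim_op n q A c x = a"
proof -
  have "(dim_op n q A c x, a) \<in> central_cong \<tau> e A c i" if i_in: "i \<in> {1..n}" for i
    using dim_op_central_cong[OF central(1) i_in x_in]
      congruence_sym[OF _ bspec[OF a_residues(2) i_in]]
      congruence_trans congruence_central_cong[OF central(1) i_in] by metis
  then show ?thesis
    using central(2) nDA_dim_op_in_univ[OF central(1) x_in] a_residues(1)
    unfolding n_central_iff[OF central(1)] by simp
qed

section \<open>Quotients by maximal congruences\<close>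

lemma central_cong_permutes:
  assumes central: "c \<in> univ A" "n_central \<tau> n e A c" and i_in: "i \<in> {1..n}"
    and cong_r: "congruence \<tau> A r"
  shows "r O central_cong \<tau> e A c i \<subseteq> central_cong \<tau> e A c i O r"
proof clarify
  fix x y z
  assume xy_in_r: "(x, y) \<in> r" and yz_in_central_cong: "(y, z) \<in> central_cong \<tau> e A c i"
  note cong_central = congruence_central_cong[OF central(1)]
  have xyz_in: "x \<in> univ A" "y \<in> univ A" "z \<in> univ A"
    using congruence_field[OF cong_r xy_in_r]
      congruence_field[OF cong_central[OF i_in] yz_in_central_cong] by auto
  let ?w = "dim_op n q A c ((\<lambda>_. z)(i := x))"
  have "(?w, x) \<in> central_cong \<tau> e A c i"
    using dim_op_central_cong[OF central(1) i_in, of "(\<lambda>_. z)(i := x)"] xyz_in by simp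
  then have "(x, ?w) \<in> central_cong \<tau> e A c i"
    by (rule congruence_sym[OF cong_central[OF i_in]])
  moreover have "(?w, dim_op n q A c ((\<lambda>_. z)(i := y))) \<in> r"
    using central(1) xyz_in xy_in_r congruence_refl[OF cong_r]
    by (intro nDA_congruence_dim_op[OF cong_r]) simp_all
  moreover have "dim_op n q A c ((\<lambda>_. z)(i := y)) = z"
    using xyz_in congruence_sym[OF cong_central[OF i_in] yz_in_central_cong]
      congruence_refl[OF cong_central]
    by (intro n_central_dim_op_eqI[OF central]) simp_all
  ultimately show "(x, z) \<in> central_cong \<tau> e A c i O r"
    by auto
qed

lemma Inter_central_cong_relcomp:
  assumes central: "c \<in> univ A" "n_central \<tau> n e A c" and cong_r: "congruence \<tau> A r"
    and ab_in: "a \<in> univ A" "b \<in> univ A"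
    and ab_in_relcomp: "\<And>i. i \<in> {1..n} \<Longrightarrow> (a, b) \<in> central_cong \<tau> e A c i O r"
  shows "(a, b) \<in> r"
proof -
  have "\<forall>i\<in>{1..n}. \<exists>y. (a, y) \<in> central_cong \<tau> e A c i \<and> (y, b) \<in> r"
    using ab_in_relcomp by blast
  then obtain m where m_between: "\<forall>i\<in>{1..n}. (a, m i) \<in> central_cong \<tau> e A c i"
      "\<forall>i\<in>{1..n}. (m i, b) \<in> r"
    by metis
  have "m \<in> {1..n} \<rightarrow> univ A"
    using m_between(2) congruence_field[OF cong_r] by blast
  then have "dim_op n q A c m = a"
    by (rule n_central_dim_op_eqI[OF central _ ab_in(1) m_between(1)])
  moreover have "dim_op n q A c (\<lambda>_. b) = b"
    using ab_in(2) congruence_refl[OF congruence_central_cong[OF central(1)] ab_in(2)]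
    by (intro n_central_dim_op_eqI[OF central]) simp_all
  moreover have "(dim_op n q A c m, dim_op n q A c (\<lambda>_. b)) \<in> r"
    using congruence_refl[OF cong_r central(1)] m_between(2)
    by (intro nDA_congruence_dim_op[OF cong_r]) simp_all
  ultimately show ?thesis
    by simp
qed

lemma n_central_maximal_omitting:
  assumes central: "c \<in> univ A" "n_central \<tau> n e A c" and max: "maximal_omitting \<tau> A (a, b) r"
    and ab_in: "a \<in> univ A" "b \<in> univ A"
  shows "\<exists>i\<in>{1..n}. (c, term_op A (e i) []) \<in> r"
proof -
  have cong_r: "congruence \<tau> A r" and "(a, b) \<notin> r"
    using max unfolding maximal_omitting_def by auto
  then obtain i where i_in: "i \<in> {1..n}" and omit: "(a, b) \<notin> central_cong \<tau> e A c i O r"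
    using Inter_central_cong_relcomp[OF central cong_r ab_in] by blast
  note cong_central = congruence_central_cong[OF central(1) i_in]
  have "r \<subseteq> central_cong \<tau> e A c i O r"
    using congruence_field[OF cong_r] congruence_refl[OF cong_central] by (auto simp: subset_iff)
  then have "central_cong \<tau> e A c i O r = r"
    using congruence_relcomp[OF cong_central cong_r central_cong_permutes[OF central i_in cong_r]]
      max omit unfolding maximal_omitting_def by blast
  moreover have "(c, term_op A (e i) []) \<in> central_cong \<tau> e A c i O r"
    using princ_cong_contains[of c "term_op A (e i) []"]
      congruence_refl[OF cong_r nDA_const_in_univ[OF i_in]]
    unfolding central_cong_def by (rule relcompI)
  ultimately show ?thesis
    using i_in by blast
qed

end

definition coordinate ::
    "'f signature \<Rightarrow> nat \<Rightarrow> (nat \<Rightarrow> 'f tm) \<Rightarrow> ('f, 'a) algebra \<Rightarrow> ('a \<Rightarrow> nat) \<Rightarrow> bool" where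
  "coordinate \<tau> n e A k \<longleftrightarrow> congruence \<tau> A (kernel_on (univ A) k) \<and> k ` univ A \<subseteq> {1..n} \<and>
     (\<forall>i\<in>{1..n}. k (term_op A (e i) []) = i)"

lemma coordinate_dim_op:
  assumes nDA: "is_nDA \<tau> n q e A" and coord: "coordinate \<tau> n e A k"
    and c_in: "c \<in> univ A" and x_in: "x \<in> {1..n} \<rightarrow> univ A"
  shows "k (dim_op n q A c x) = k (x (k c))"
proof -
  have index_in: "k c \<in> {1..n}"
    using coord c_in unfolding coordinate_def by blast
  then have "(c, term_op A (e (k c)) []) \<in> kernel_on (univ A) k"
    using coord c_in nDA_const_in_univ[OF nDA index_in] unfolding coordinate_def kernel_on_iff
    by simp
  moreover have "congruence \<tau> A (kernel_on (univ A) k)"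
    using coord unfolding coordinate_def by blast
  ultimately have "(dim_op n q A c x, x (k c)) \<in> kernel_on (univ A) k"
    by (intro nDA_dim_op_congruent[OF nDA _ _ index_in x_in])
  then show ?thesis
    unfolding kernel_on_iff by simp
qed

theorem nBA_coordinates_separate:
  assumes nBA: "is_nBA \<tau> n q e A" and ab_distinct: "a \<in> univ A" "b \<in> univ A" "a \<noteq> b"
  obtains k where "coordinate \<tau> n e A k" and "k a \<noteq> k b"
proof -
  have nDA: "is_nDA \<tau> n q e A" and central: "\<And>c. c \<in> univ A \<Longrightarrow> n_central \<tau> n e A c"
    using nBA unfolding is_nBA_def by auto
  obtain r where max: "maximal_omitting \<tau> A (a, b) r"
    using ex_maximal_omitting[OF nDA_is_algebra[OF nDA] ab_distinct(3)] by blast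
  then have cong_r: "congruence \<tau> A r" and "(a, b) \<notin> r"
    unfolding maximal_omitting_def by auto
  then have const_eq: "i = j"
    if "i \<in> {1..n}" "j \<in> {1..n}" "(term_op A (e i) [], term_op A (e j) []) \<in> r" for i j
    using nDA_congruent_consts[OF nDA cong_r that(1,2) _ that(3) ab_distinct(1,2)] by blast
  have "\<forall>c\<in>univ A. \<exists>i. i \<in> {1..n} \<and> (c, term_op A (e i) []) \<in> r"
    using n_central_maximal_omitting[OF nDA _ central max ab_distinct(1,2)] by blast
  then obtain k where k_index: "\<forall>c\<in>univ A. k c \<in> {1..n} \<and> (c, term_op A (e (k c)) []) \<in> r"
    by (rule bchoice[THEN exE])
  have k_eq_iff: "k x = k y \<longleftrightarrow> (x, y) \<in> r" if xy_in: "x \<in> univ A" "y \<in> univ A" for x y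
  proof
    assume "k x = k y"
    then show "(x, y) \<in> r"
      using k_index xy_in by (metis congruence_sym[OF cong_r] congruence_trans[OF cong_r])
  next
    assume "(x, y) \<in> r"
    then show "k x = k y"
      using k_index xy_in by (metis const_eq congruence_sym[OF cong_r] congruence_trans[OF cong_r])
  qed
  have "kernel_on (univ A) k = r"
    using k_eq_iff congruence_field[OF cong_r] by (auto simp: kernel_on_iff)
  moreover have "k (term_op A (e i) []) = i" if i_in: "i \<in> {1..n}" for i
    using bspec[OF k_index nDA_const_in_univ[OF nDA i_in]] const_eq[OF i_in] by metis
  ultimately have "coordinate \<tau> n e A k"
    unfolding coordinate_def using cong_r k_index by blast
  then show thesis
    using that k_eq_iff[OF ab_distinct(1,2)] \<open>(a, b) \<notin> r\<close> by blast
qed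

section \<open>Varieties of Boolean-like algebras\<close>

text \<open>
  The quotient is realised on the constants themselves, so that its universe stays within the type
  \<open>'a\<close> over which the variety is taken.
\<close>

lemma coordinate_n_element_image:
  fixes A :: "('f, 'a) algebra"
  assumes nDA: "is_nDA \<tau> n q e A" and coord: "coordinate \<tau> n e A k"
  obtains B :: "('f, 'a) algebra" and h
  where "alg_hom \<tau> A B h" and "h ` univ A = univ B" and "card (univ B) = n"
    and "kernel_on (univ A) h = kernel_on (univ A) k"
proof
  define h where "h x = term_op A (e (k x)) []" for x
  have k_const: "k (term_op A (e i) []) = i" if "i \<in> {1..n}" for i
    using coord that unfolding coordinate_def by blast
  have "k ` univ A \<subseteq> {1..n}"
    using coord unfolding coordinate_def by blast
  moreover have "{1..n} \<subseteq> k ` univ A"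
    using k_const nDA_const_in_univ[OF nDA] by (metis image_eqI subsetI)
  ultimately have k_image: "k ` univ A = {1..n}" ..
  have inj: "inj_on (\<lambda>i. term_op A (e i) []) {1..n}"
    using k_const by (rule inj_on_inverseI)
  have "h x = h y \<longleftrightarrow> k x = k y" if "x \<in> univ A" "y \<in> univ A" for x y
    unfolding h_def using inj_on_eq_iff[OF inj] k_image that by blast
  then show kernel_h: "kernel_on (univ A) h = kernel_on (univ A) k"
    by (auto simp: kernel_on_iff)
  show "alg_hom \<tau> A (image_alg A h) h"
    using coord unfolding coordinate_def kernel_h[symmetric]
    by (intro alg_hom_image_alg[OF nDA_is_algebra[OF nDA]]) blast
  show "h ` univ A = univ (image_alg A h)"
    by (simp add: image_alg_def)
  have "h ` univ A = (\<lambda>i. term_op A (e i) []) ` {1..n}"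
    unfolding h_def k_image[symmetric] image_image ..
  then show "card (univ (image_alg A h)) = n"
    using card_image[OF inj] by (simp add: image_alg_def)
qed

theorem nBA_variety_generated:
  fixes V :: "('f, 'a) algebra set"
  assumes V_variety: "variety_of_nBAs \<tau> n q e V"
  shows "V = generated_variety \<tau> {A \<in> V. card (univ A) = n}"
proof
  show "V \<subseteq> generated_variety \<tau> {A \<in> V. card (univ A) = n}"
  proof
    fix A
    assume A_in_V: "A \<in> V"
    then have nBA: "is_nBA \<tau> n q e A"
      using V_variety unfolding variety_of_nBAs_def by blast
    then have nDA: "is_nDA \<tau> n q e A"
      unfolding is_nBA_def by blast
    show "A \<in> generated_variety \<tau> {A \<in> V. card (univ A) = n}"
    proof (rule residually_in_generated_variety[OF nDA_is_algebra[OF nDA]])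
      fix a b
      assume ab_distinct: "a \<in> univ A" "b \<in> univ A" "a \<noteq> b"
      then obtain k where coord: "coordinate \<tau> n e A k" "k a \<noteq> k b"
        using nBA_coordinates_separate[OF nBA] by blast
      then obtain B :: "('f, 'a) algebra" and h
        where hom_onto: "alg_hom \<tau> A B h" "h ` univ A = univ B"
          and "card (univ B) = n" and same_kernel: "kernel_on (univ A) h = kernel_on (univ A) k"
        using coordinate_n_element_image[OF nDA] by blast
      moreover have "B \<in> V"
        using V_variety hom_image_in_variety[OF _ A_in_V hom_onto] unfolding variety_of_nBAs_def
        by blast
      moreover have "h a \<noteq> h b"
        using coord(2) ab_distinct(1,2) same_kernel by (metis kernel_on_iff)
      ultimately show "\<exists>B\<in>{A \<in> V. card (univ A) = n}. \<exists>h. alg_hom \<tau> A B h \<and> h a \<noteq> h b"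
        by blast
    qed
  qed
next
  show "generated_variety \<tau> {A \<in> V. card (univ A) = n} \<subseteq> V"
    using V_variety unfolding variety_of_nBAs_def by (intro generated_variety_least) auto
qed

section \<open>Pure Boolean-like algebras\<close>

definition slice :: "nat \<Rightarrow> 'f tm \<Rightarrow> ('f, 'a) algebra \<Rightarrow> 'a \<Rightarrow> nat \<Rightarrow> 'a \<Rightarrow> 'a" where
  "slice n q A c i x = dim_op n q A c ((\<lambda>_. c)(i := x))"

lemma n_centralI_slice:
  assumes nDA: "is_nDA \<tau> n q e A" and c_in: "c \<in> univ A"
    and slice_oper: "\<And>i f xs. i \<in> {1..n} \<Longrightarrow> \<tau> f = Some (length xs) \<Longrightarrow> set xs \<subseteq> univ A \<Longrightarrow>
      slice n q A c i (oper A f xs) = slice n q A c i (oper A f (map (slice n q A c i) xs))"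
    and slice_const: "\<And>i. i \<in> {1..n} \<Longrightarrow>
      slice n q A c i c = slice n q A c i (term_op A (e i) [])"
    and reassemble: "\<And>x. x \<in> univ A \<Longrightarrow> dim_op n q A c (\<lambda>i. slice n q A c i x) = x"
  shows "n_central \<tau> n e A c"
proof -
  have central_cong_subset: "central_cong \<tau> e A c i \<subseteq> kernel_on (univ A) (slice n q A c i)"
    if i_in: "i \<in> {1..n}" for i
    unfolding central_cong_def
  proof (rule princ_cong_least)
    show "congruence \<tau> A (kernel_on (univ A) (slice n q A c i))"
      by (rule congruence_kernel_onI[OF nDA_is_algebra[OF nDA] slice_oper[OF i_in]])
    show "(c, term_op A (e i) []) \<in> kernel_on (univ A) (slice n q A c i)"
      using c_in slice_const[OF i_in] nDA_const_in_univ[OF nDA i_in] unfolding kernel_on_iff by simp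
  qed
  show ?thesis
    unfolding n_central_iff[OF nDA c_in]
  proof (intro ballI impI)
    fix x y
    assume xy_in: "x \<in> univ A" "y \<in> univ A"
      and "\<forall>i\<in>{1..n}. (x, y) \<in> central_cong \<tau> e A c i"
    then have "(x, y) \<in> kernel_on (univ A) (slice n q A c i)" if "i \<in> {1..n}" for i
      using central_cong_subset[OF that] that by blast
    then have "slice n q A c i x = slice n q A c i y" if "i \<in> {1..n}" for i
      using that by (simp add: kernel_on_iff)
    then have "dim_op n q A c (\<lambda>i. slice n q A c i x) = dim_op n q A c (\<lambda>i. slice n q A c i y)"
      by (rule dim_op_cong)
    then show "x = y"
      using reassemble xy_in by simp
  qed
qed

abbreviation nu_q :: "nat \<Rightarrow> nu_sym tm" where
  "nu_q n \<equiv> Fun Qsym (map Var [0..<Suc n])"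

abbreviation nu_e :: "nat \<Rightarrow> nu_sym tm" where
  "nu_e i \<equiv> Fun (Esym i) []"

lemma term_op_nu_e: "term_op A (nu_e i) [] = oper A (Esym i) []"
  by (simp add: term_op_def)

lemma dim_op_nu_q: "dim_op n (nu_q n) A c x = oper A Qsym (c # map x [1..<Suc n])"
  using map_nth[of "c # map x [1..<Suc n]"] by (simp add: dim_op_def term_op_def comp_def)

lemma oper_Qsym_eq_dim_op:
  assumes "length xs = Suc n"
  shows "oper A Qsym xs = dim_op n (nu_q n) A (xs ! 0) ((!) xs)"
proof -
  have "xs = map ((!) xs) [0..<Suc n]"
    using map_nth[of xs] assms by simp
  also have "\<dots> = xs ! 0 # map ((!) xs) [1..<Suc n]"
    by (simp add: upt_conv_Cons)
  finally show ?thesis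
    unfolding dim_op_nu_q by (rule arg_cong)
qed

lemma dim_terms_nu: "dim_terms (nu_sig n) n (nu_q n) nu_e"
  by (auto simp: dim_terms_def nu_sig_def list_all_iff)

lemma nu_sig_Qsym: "nu_sig n Qsym = Some (Suc n)"
  by (simp add: nu_sig_def)

lemma nu_sig_Esym: "i \<in> {1..n} \<Longrightarrow> nu_sig n (Esym i) = Some 0"
  by (simp add: nu_sig_def)

lemma nu_sig_cases:
  assumes "nu_sig n f = Some (length xs)"
  obtains (Esym) i where "f = Esym i" and "i \<in> {1..n}" and "xs = []"
  | (Qsym) "f = Qsym" and "length xs = Suc n"
  using assms by (cases f) (auto simp: nu_sig_def split: if_splits)

subsection \<open>The algebra \<open>\<^bold>n\<close>\<close>

lemma oper_alg_n_Esym: "oper (alg_n n \<epsilon>) (Esym i) xs = \<epsilon> i"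
  by (simp add: alg_n_def)

lemma dim_op_alg_n:
  assumes "inj_on \<epsilon> {1..n}" and "k \<in> {1..n}"
  shows "dim_op n (nu_q n) (alg_n n \<epsilon>) (\<epsilon> k) x = x k"
proof -
  have "dim_op n (nu_q n) (alg_n n \<epsilon>) (\<epsilon> k) x = (\<epsilon> k # map x [1..<Suc n]) ! k"
    using the_inv_into_f_f[OF assms] by (simp add: dim_op_nu_q alg_n_def)
  also have "\<dots> = x k"
    using assms(2) by (cases k) auto
  finally show ?thesis .
qed

lemma is_algebra_alg_n:
  assumes inj: "inj_on \<epsilon> {1..n}" and "n \<ge> 1"
  shows "is_algebra (nu_sig n) (alg_n n \<epsilon>)"
  unfolding is_algebra_def
proof (intro conjI allI impI)
  show "univ (alg_n n \<epsilon>) \<noteq> {}"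
    using assms(2) by (simp add: alg_n_def)
next
  fix f xs
  assume "nu_sig n f = Some (length xs) \<and> set xs \<subseteq> univ (alg_n n \<epsilon>)"
  then have arity: "nu_sig n f = Some (length xs)" and xs_in: "set xs \<subseteq> \<epsilon> ` {1..n}"
    by (simp_all add: alg_n_def)
  from arity show "oper (alg_n n \<epsilon>) f xs \<in> univ (alg_n n \<epsilon>)"
  proof (cases rule: nu_sig_cases)
    case (Esym i)
    then show ?thesis by (simp add: alg_n_def)
  next
    case Qsym
    then have nth_in: "xs ! i \<in> \<epsilon> ` {1..n}" if "i \<le> n" for i
      using xs_in that by (auto intro!: subsetD[OF _ nth_mem])
    then obtain k where k_in: "k \<in> {1..n}" and hd_eq: "xs ! 0 = \<epsilon> k"
      by blast
    have "oper (alg_n n \<epsilon>) f xs = xs ! k"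
      unfolding Qsym(1) oper_Qsym_eq_dim_op[OF Qsym(2)] hd_eq by (rule dim_op_alg_n[OF inj k_in])
    then show ?thesis
      using nth_in k_in by (simp add: alg_n_def)
  qed
qed

lemma alg_hom_coordinate_alg_n:
  assumes nDA: "is_nDA (nu_sig n) n (nu_q n) nu_e A" and inj: "inj_on \<epsilon> {1..n}"
    and coord: "coordinate (nu_sig n) n nu_e A k"
  shows "alg_hom (nu_sig n) A (alg_n n \<epsilon>) (\<epsilon> \<circ> k)"
  unfolding alg_hom_def
proof (intro conjI allI impI)
  show "(\<epsilon> \<circ> k) ` univ A \<subseteq> univ (alg_n n \<epsilon>)"
    using coord unfolding coordinate_def alg_n_def by auto
next
  fix f xs
  assume "nu_sig n f = Some (length xs) \<and> set xs \<subseteq> univ A"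
  then have arity: "nu_sig n f = Some (length xs)" and xs_in: "set xs \<subseteq> univ A"
    by auto
  from arity show "(\<epsilon> \<circ> k) (oper A f xs) = oper (alg_n n \<epsilon>) f (map (\<epsilon> \<circ> k) xs)"
  proof (cases rule: nu_sig_cases)
    case (Esym i)
    then show ?thesis
      using coord unfolding coordinate_def term_op_nu_e by (simp add: oper_alg_n_Esym)
  next
    case Qsym
    have nth_in: "xs ! i \<in> univ A" if "i \<le> n" for i
      using xs_in Qsym(2) that by (auto intro!: subsetD[OF _ nth_mem])
    have hd_index: "k (xs ! 0) \<in> {1..n}"
      using coord nth_in[of 0] unfolding coordinate_def by blast
    have "k (oper A f xs) = k (dim_op n (nu_q n) A (xs ! 0) ((!) xs))"
      unfolding Qsym(1) oper_Qsym_eq_dim_op[OF Qsym(2)] ..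
    also have "\<dots> = k (xs ! k (xs ! 0))"
      using nth_in by (intro coordinate_dim_op[OF nDA coord]) auto
    finally have "(\<epsilon> \<circ> k) (oper A f xs) = map (\<epsilon> \<circ> k) xs ! k (xs ! 0)"
      using Qsym(2) hd_index by simp
    also have "\<dots> = dim_op n (nu_q n) (alg_n n \<epsilon>) (map (\<epsilon> \<circ> k) xs ! 0) ((!) (map (\<epsilon> \<circ> k) xs))"
      using dim_op_alg_n[OF inj hd_index] Qsym(2) by simp
    also have "\<dots> = oper (alg_n n \<epsilon>) f (map (\<epsilon> \<circ> k) xs)"
      using oper_Qsym_eq_dim_op[of "map (\<epsilon> \<circ> k) xs" n] Qsym by simp
    finally show ?thesis .
  qed
qed

lemma pure_nBA_in_variety_alg_n:
  assumes "is_pure_nBA n A" and inj: "inj_on \<epsilon> {1..n}"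
  shows "A \<in> generated_variety (nu_sig n) {alg_n n \<epsilon>}"
proof -
  have nBA: "is_nBA (nu_sig n) n (nu_q n) nu_e A" and nDA: "is_nDA (nu_sig n) n (nu_q n) nu_e A"
    using assms(1) unfolding is_pure_nBA_def is_nBA_def by auto
  show ?thesis
  proof (rule residually_in_generated_variety[OF nDA_is_algebra[OF nDA]])
    fix a b
    assume ab_distinct: "a \<in> univ A" "b \<in> univ A" "a \<noteq> b"
    then obtain k where coord: "coordinate (nu_sig n) n nu_e A k" "k a \<noteq> k b"
      using nBA_coordinates_separate[OF nBA] by blast
    then have "(\<epsilon> \<circ> k) a \<noteq> (\<epsilon> \<circ> k) b"
      using ab_distinct(1,2) inj_onD[OF inj] unfolding coordinate_def
      by (metis comp_apply image_subset_iff)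
    then show "\<exists>B\<in>{alg_n n \<epsilon>}. \<exists>h. alg_hom (nu_sig n) A B h \<and> h a \<noteq> h b"
      using alg_hom_coordinate_alg_n[OF nDA inj coord(1)] by blast
  qed
qed

subsection \<open>Identities of \<open>\<^bold>n\<close>\<close>

definition dim_tm :: "nat \<Rightarrow> nu_sym tm \<Rightarrow> (nat \<Rightarrow> nu_sym tm) \<Rightarrow> nu_sym tm" where
  "dim_tm n t ts = Fun Qsym (t # map ts [1..<Suc n])"

definition slice_tm :: "nat \<Rightarrow> nu_sym tm \<Rightarrow> nat \<Rightarrow> nu_sym tm \<Rightarrow> nu_sym tm" where
  "slice_tm n c i t = dim_tm n c ((\<lambda>_. c)(i := t))"

lemma eval_dim_tm:
  "eval A \<rho> (dim_tm n t ts) = dim_op n (nu_q n) A (eval A \<rho> t) (\<lambda>i. eval A \<rho> (ts i))"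
  by (simp add: dim_tm_def dim_op_nu_q comp_def)

lemma eval_slice_tm:
  "eval A \<rho> (slice_tm n c i t) = slice n (nu_q n) A (eval A \<rho> c) i (eval A \<rho> t)"
  unfolding slice_tm_def slice_def eval_dim_tm by (rule dim_op_cong) simp

lemma wf_dim_tm:
  "wf_tm (nu_sig n) t \<Longrightarrow> (\<And>i. i \<in> {1..n} \<Longrightarrow> wf_tm (nu_sig n) (ts i)) \<Longrightarrow>
    wf_tm (nu_sig n) (dim_tm n t ts)"
  by (auto simp: dim_tm_def nu_sig_Qsym list_all_iff)

lemma wf_slice_tm:
  "wf_tm (nu_sig n) c \<Longrightarrow> wf_tm (nu_sig n) t \<Longrightarrow> wf_tm (nu_sig n) (slice_tm n c i t)"
  unfolding slice_tm_def by (rule wf_dim_tm) auto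

lemma slice_alg_n:
  assumes "inj_on \<epsilon> {1..n}" and "k \<in> {1..n}"
  shows "slice n (nu_q n) (alg_n n \<epsilon>) (\<epsilon> k) i x = (if i = k then x else \<epsilon> k)"
  unfolding slice_def dim_op_alg_n[OF assms] by auto

context
  fixes n :: nat and \<epsilon> :: "nat \<Rightarrow> 'a" and A :: "(nu_sym, 'a) algebra"
  assumes inj: "inj_on \<epsilon> {1..n}" and pos: "n \<ge> 1"
    and A_in: "A \<in> generated_variety (nu_sig n) {alg_n n \<epsilon>}"
begin

lemma variety_alg_n_is_algebra: "is_algebra (nu_sig n) A"
  using generated_variety_is_algebra[OF A_in] is_algebra_alg_n[OF inj pos] by blast

lemma variety_alg_n_eval_eq:
  assumes "wf_tm (nu_sig n) s" and "wf_tm (nu_sig n) t" and "range \<rho> \<subseteq> univ A"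
    and alg_n_eq: "\<And>\<sigma> k. k \<in> {1..n} \<Longrightarrow> \<sigma> 0 = \<epsilon> k \<Longrightarrow> eval (alg_n n \<epsilon>) \<sigma> s = eval (alg_n n \<epsilon>) \<sigma> t"
  shows "eval A \<rho> s = eval A \<rho> t"
proof -
  have "eval (alg_n n \<epsilon>) \<sigma> s = eval (alg_n n \<epsilon>) \<sigma> t" if "range \<sigma> \<subseteq> \<epsilon> ` {1..n}" for \<sigma>
    using range_subsetD[OF that, of 0] alg_n_eq by blast
  then have "satisfies (alg_n n \<epsilon>) (s, t)"
    by (simp add: satisfies_def alg_n_def)
  then have "satisfies A (s, t)"
    using is_algebra_alg_n[OF inj pos]
    by (intro generated_variety_satisfies[OF A_in _ assms(1,2)]) auto
  then show ?thesis
    using assms(3) by (rule satisfiesD)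
qed

lemma variety_alg_n_is_nDA: "is_nDA (nu_sig n) n (nu_q n) nu_e A"
  unfolding is_nDA_def dim_op_def[symmetric]
proof (intro conjI allI impI ballI)
  fix x i
  assume x_in: "\<forall>j\<in>{1..n}. x j \<in> univ A" and i_in: "i \<in> {1..n}"
  define \<rho> where "\<rho> j = (if j \<in> {1..n} then x j else x i)" for j
  have "eval A \<rho> (dim_tm n (nu_e i) Var) = eval A \<rho> (Var i)"
  proof (rule variety_alg_n_eval_eq)
    show "wf_tm (nu_sig n) (dim_tm n (nu_e i) Var)"
      using i_in by (intro wf_dim_tm) (simp_all add: nu_sig_Esym)
    show "range \<rho> \<subseteq> univ A"
      using x_in i_in by (auto simp: \<rho>_def)
    show "eval (alg_n n \<epsilon>) \<sigma> (dim_tm n (nu_e i) Var) = eval (alg_n n \<epsilon>) \<sigma> (Var i)" for \<sigma>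
      using dim_op_alg_n[OF inj i_in] by (simp add: eval_dim_tm alg_n_def)
  qed simp
  then have "dim_op n (nu_q n) A (term_op A (nu_e i) []) \<rho> = x i"
    using i_in \<rho>_def[of i] by (simp add: eval_dim_tm term_op_nu_e)
  also have "dim_op n (nu_q n) A (term_op A (nu_e i) []) \<rho> =
      dim_op n (nu_q n) A (term_op A (nu_e i) []) x"
    by (rule dim_op_cong) (simp add: \<rho>_def)
  finally show "dim_op n (nu_q n) A (term_op A (nu_e i) []) x = x i" .
qed (rule variety_alg_n_is_algebra dim_terms_nu)+

lemma variety_alg_n_slice_Qsym:
  assumes c_in: "c \<in> univ A" and xs_in: "set xs \<subseteq> univ A" "length xs = Suc n"
  shows "slice n (nu_q n) A c i (oper A Qsym xs) =
    slice n (nu_q n) A c i (oper A Qsym (map (slice n (nu_q n) A c i) xs))"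
proof -
  let ?x = "\<lambda>j. Var (Suc j)"
  let ?s = "slice_tm n (Var 0) i (Fun Qsym (map ?x [0..<Suc n]))"
  let ?t = "slice_tm n (Var 0) i (Fun Qsym (map (\<lambda>j. slice_tm n (Var 0) i (?x j)) [0..<Suc n]))"
  define \<rho> where "\<rho> j = (if j \<le> Suc n then (c # xs) ! j else c)" for j
  have "eval A \<rho> ?s = eval A \<rho> ?t"
  proof (rule variety_alg_n_eval_eq)
    show "wf_tm (nu_sig n) ?s" "wf_tm (nu_sig n) ?t"
      by (auto intro!: wf_slice_tm simp: nu_sig_Qsym list_all_iff)
    show "range \<rho> \<subseteq> univ A"
      using c_in xs_in by (auto simp: \<rho>_def nth_Cons' intro!: subsetD[OF _ nth_mem])
  next
    fix \<sigma> :: "nat \<Rightarrow> 'a" and k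
    assume "k \<in> {1..n}" "\<sigma> 0 = \<epsilon> k"
    then show "eval (alg_n n \<epsilon>) \<sigma> ?s = eval (alg_n n \<epsilon>) \<sigma> ?t"
      by (simp add: eval_slice_tm slice_alg_n[OF inj] comp_def)
  qed
  moreover have "map (\<lambda>j. f (\<rho> (Suc j))) [0..<Suc n] = map f xs" for f :: "'a \<Rightarrow> 'a"
    using xs_in(2) by (intro nth_equalityI) (auto simp: \<rho>_def)
  moreover from this[of id] have "map (\<lambda>j. \<rho> (Suc j)) [0..<Suc n] = xs"
    by simp
  moreover have "\<rho> 0 = c"
    by (simp add: \<rho>_def)
  ultimately show ?thesis
    by (simp add: eval_slice_tm comp_def)
qed

lemma variety_alg_n_slice_const:
  assumes c_in: "c \<in> univ A" and i_in: "i \<in> {1..n}"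
  shows "slice n (nu_q n) A c i c = slice n (nu_q n) A c i (term_op A (nu_e i) [])"
proof -
  have "eval A (\<lambda>_. c) (slice_tm n (Var 0) i (Var 0)) =
      eval A (\<lambda>_. c) (slice_tm n (Var 0) i (nu_e i))"
  proof (rule variety_alg_n_eval_eq)
    show "wf_tm (nu_sig n) (slice_tm n (Var 0) i (Var 0))"
        "wf_tm (nu_sig n) (slice_tm n (Var 0) i (nu_e i))"
      using i_in by (auto intro!: wf_slice_tm simp: nu_sig_Esym)
    show "range (\<lambda>_. c) \<subseteq> univ A"
      using c_in by simp
  next
    fix \<sigma> :: "nat \<Rightarrow> 'a" and k
    assume "k \<in> {1..n}" "\<sigma> 0 = \<epsilon> k"
    then show "eval (alg_n n \<epsilon>) \<sigma> (slice_tm n (Var 0) i (Var 0)) =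
        eval (alg_n n \<epsilon>) \<sigma> (slice_tm n (Var 0) i (nu_e i))"
      by (simp add: eval_slice_tm slice_alg_n[OF inj] oper_alg_n_Esym)
  qed
  then show ?thesis
    by (simp add: eval_slice_tm term_op_nu_e)
qed

lemma variety_alg_n_dim_op_slices:
  assumes "c \<in> univ A" and "x \<in> univ A"
  shows "dim_op n (nu_q n) A c (\<lambda>i. slice n (nu_q n) A c i x) = x"
proof -
  define \<rho> :: "nat \<Rightarrow> 'a" where "\<rho> = (\<lambda>_. x)(0 := c)"
  have "eval A \<rho> (dim_tm n (Var 0) (\<lambda>i. slice_tm n (Var 0) i (Var 1))) = eval A \<rho> (Var 1)"
  proof (rule variety_alg_n_eval_eq)
    show "wf_tm (nu_sig n) (dim_tm n (Var 0) (\<lambda>i. slice_tm n (Var 0) i (Var 1)))"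
      by (intro wf_dim_tm wf_slice_tm) auto
    show "range \<rho> \<subseteq> univ A"
      using assms by (auto simp: \<rho>_def)
  next
    fix \<sigma> :: "nat \<Rightarrow> 'a" and k
    assume "k \<in> {1..n}" "\<sigma> 0 = \<epsilon> k"
    then show "eval (alg_n n \<epsilon>) \<sigma> (dim_tm n (Var 0) (\<lambda>i. slice_tm n (Var 0) i (Var 1))) =
        eval (alg_n n \<epsilon>) \<sigma> (Var 1)"
      by (simp add: eval_dim_tm eval_slice_tm slice_alg_n[OF inj] dim_op_alg_n[OF inj])
  qed simp
  then show ?thesis
    by (simp add: eval_dim_tm eval_slice_tm \<rho>_def)
qed

lemma variety_alg_n_is_pure_nBA: "is_pure_nBA n A"
  unfolding is_pure_nBA_def is_nBA_def
proof (intro conjI ballI)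
  fix c
  assume c_in: "c \<in> univ A"
  show "n_central (nu_sig n) n nu_e A c"
  proof (rule n_centralI_slice[OF variety_alg_n_is_nDA c_in])
    fix i f xs
    assume "nu_sig n f = Some (length xs)" and "set xs \<subseteq> univ A"
    then show "slice n (nu_q n) A c i (oper A f xs) =
        slice n (nu_q n) A c i (oper A f (map (slice n (nu_q n) A c i) xs))"
      using variety_alg_n_slice_Qsym[OF c_in] by (cases rule: nu_sig_cases) simp_all
  qed (rule variety_alg_n_slice_const[OF c_in] variety_alg_n_dim_op_slices[OF c_in]; assumption)+
qed (rule variety_alg_n_is_nDA)

end

theorem pure_nBAs_generated:
  assumes "inj_on \<epsilon> {1..n}" and "n \<ge> 1"
  shows "{A. is_pure_nBA n A} = generated_variety (nu_sig n) {alg_n n \<epsilon>}"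
  using pure_nBA_in_variety_alg_n[OF _ assms(1)] variety_alg_n_is_pure_nBA[OF assms] by blast

theorem theorem4p6:
  fixes n :: nat
  assumes "n \<ge> 2"
  shows "(\<forall>(\<tau> :: 'f signature) q e (V :: ('f, 'a) algebra set).
            variety_of_nBAs \<tau> n q e V \<longrightarrow>
            V = generated_variety \<tau> {A \<in> V. card (univ A) = n})
       \<and> (\<forall>\<epsilon> :: nat \<Rightarrow> 'a. inj_on \<epsilon> {1..n} \<longrightarrow>
            {A. is_pure_nBA n A} = generated_variety (nu_sig n) {alg_n n \<epsilon>})"
proof (intro conjI allI impI)
  fix \<tau> :: "'f signature" and q e and V :: "('f, 'a) algebra set"
  assume "variety_of_nBAs \<tau> n q e V"
  then show "V = generated_variety \<tau> {A \<in> V. card (univ A) = n}"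
    by (rule nBA_variety_generated)
next
  fix \<epsilon> :: "nat \<Rightarrow> 'a"
  assume "inj_on \<epsilon> {1..n}"
  then show "{A. is_pure_nBA n A} = generated_variety (nu_sig n) {alg_n n \<epsilon>}"
    using assms by (intro pure_nBAs_generated) simp_all
qed

end
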